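(* Let $P$ be a globally stratified plain LARS program, let $S$ be a stream, and let $P'$ be the program obtained from $P$ by the translation $\mathsf{pLARS2TD}$ described in the context. Then $P'$ is a Temporal Datalog$^{\rightarrow}_{\circleddash}$ program. Moreover, let $I^*$ be the perfect model of $P'\cup S$ (where the occurrence of a fact $p(\boldsymbol{x})$ at time-point $s$ in $S$ is read as the fact $p(\boldsymbol{x},s)$). Then for every time-point $t$, predicate $p$ of $P$, ground object tuple $\boldsymbol{X}$, time-point $t'$ and positive integer $d$, at time-point $t$ the program $P\cup S$ derives: (1) $p(\boldsymbol{X})$ iff $I^*\models p(\boldsymbol{X},t)$; (2) $@_{t'}\,p(\boldsymbol{X})$ iff $I^*\models p(\boldsymbol{X},t')$; (3) $\boxplus^{d}@_{t'}\,p(\boldsymbol{X})$ iff $I^*\models p(\boldsymbol{X},t')$ and $t-d\le t'\le t$; (4) $\boxplus^{d}\Diamond p(\boldsymbol{X})$ iff $I^*\models p^{d}_{\Diamond}(\boldsymbol{X},t)$; (5) $\boxplus^{d}\Box p(\boldsymbol{X})$ iff $I^*\models p^{d}_{\Box}(\boldsymbol{X},t)$; where (4) and (5) concern those $p,d$ for which the auxiliary predicate $p^d_\Diamond$, respectively $p^d_\Box$, has been introduced by the translation.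
   Context: **Time and streams.** Time-points are positive integers; constants are split into objects and time-points, variables into object variables and time variables. An object term is an object or object variable. A predicate is intensional if it occurs in the head of a rule with non-empty body, and extensional otherwise. A stream is an (unbounded) set of facts with extensional predicates, each with one time-point. **Plain LARS.** Let $a=p(\boldsymbol{X})$ be an atom over object terms, $T'$ a time variable, $d$ a positive integer. Extended atoms are $e ::= a \mid @_{T'}a \mid \boxplus^d @_{T'}a \mid \boxplus^d\Diamond a\mid \boxplus^d\Box a$. A plain LARS program is a set of rules $h\leftarrow b_1,\dots,b_m$ with $h$ an atom and each $b_i$ a possibly negated extended atom. In every rule, every time variable $T'$ occurs in some positive (non-negated) condition $\boxplus^{d}@_{T'}p(\boldsymbol X)$; the first such condition restricts $T'$ to $\{T-d,\dots,T\}$, where $T$ is the evaluation time of the rule. $P$ is globally stratified if its predicates can be partitioned into strata $\Sigma_1,\dots,\Sigma_n$ such that for each rule with head predicate in $\Sigma_i$, predicates of non-negated conditions lie in some $\Sigma_j$, $j\le i$, and predicates of negated conditions in some $\Sigma_j$, $j<i$. **LARS semantics.** Relative to a set $M$ of pairs (ground atom, time-point), a ground extended atom is satisfied at $t$ as follows: $a$ iff $(a,t)\in M$; $@_{t'}a$ iff $(a,t')\in M$; $\boxplus^d@_{t'}a$ iff $t-d\le t'\le t$ and $(a,t')\in M$; $\boxplus^d\Diamond a$ iff $(a,s)\in M$ for some $s\in\{t-d,\dots,t\}$; $\boxplus^d\Box a$ iff $(a,s)\in M$ for every $s\in\{t-d,\dots,t\}$ (no atom holds at a non-positive time). A negated condition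 is satisfied iff the condition is not. The meaning of $P\cup S$ is the unique $M$ obtained stratum by stratum: for $i=1,\dots,n$, add to the pairs obtained for lower strata the least set of pairs with predicates in $\Sigma_i$ that contains the corresponding facts of $S$ and is closed under all ground rule instances, at all time-points $t$, whose head predicate is in $\Sigma_i$ (negated conditions being evaluated on the lower strata). "At $t$, $P\cup S$ derives $e$" means $e$ is satisfied at $t$ relative to this $M$. **Temporal Datalog$^{\rightarrow}_{\circleddash}$.** Rules are function-free and have the form $$h(\boldsymbol{X_h},T)\leftarrow b_1(\boldsymbol{X_{b_1}},T-k_{b_1}),\dots,b_m(\boldsymbol{X_{b_m}},T-k_{b_m}),\ \mathsf{not}\ c_1(\boldsymbol{X_{c_1}},T-k_{c_1}),\dots,\mathsf{not}\ c_k(\boldsymbol{X_{c_k}},T-k_{c_k}),$$ with one time variable $T$, object-term tuples and integer offsets. Atoms with non-positive time are false. A program is *forward-propagating* if all offsets are non-negative. A program is *locally stratified* if its ground atoms can be partitioned into a (possibly infinite) sequence of strata $B_1,B_2,\dots$ so that in each ground rule instance with head in $B_i$, atoms of positive conditions lie in strata $B_j$ with $j\le i$ and atoms of negative conditions in strata $B_j$ with $j<i$. A program is *temporally stratified* if the program obtained by deleting all object terms (each predicate keeping only its time argument) is locally stratified. A Temporal Datalog$^{\rightarrow}_{\circleddash}$ program is a forward-propagating, temporally stratified set of such rules. Its *perfect model* (together with a stream) is the unique model obtained by evaluating ground rules bottom-up along a local stratification, taking in each stratum the least set closed under the rules, with $\mathsf{not}\ c$ true iff $c$ was not derived in lower strata.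 **The translation $\mathsf{pLARS2TD}$.** Each predicate $p$ of arity $n$ becomes a predicate $p$ of arity $n+1$ whose last argument is time. For each rule $r$ of $P$ and each time variable $T'$ in $r$, let $d_{T'}$ be the window size of the first positive condition $\boxplus^{d}@_{T'}p(\boldsymbol X)$ in $r$. For each map $\mu$ sending every time variable $T'$ of $r$ to some $T-i$ with $0\le i\le d_{T'}$, the program $P'$ contains the rule obtained from $r$ by replacing the head $p_h(\boldsymbol X)$ by $p_h(\boldsymbol X,T)$ and each body condition (under its negation, if any, with $\neg$ replaced by $\mathsf{not}$) as follows: - $p(\boldsymbol X)$ by $p(\boldsymbol X,T)$; - $@_{T'}p(\boldsymbol X)$ by $p(\boldsymbol X,\mu(T'))$; - $\boxplus^d@_{T'}p(\boldsymbol X)$ by $p(\boldsymbol X,\mu(T'))$ if $T-d\le\mu(T')$, and otherwise by $\bot$ (an always-false atom, never derivable); - $\boxplus^d\Diamond p(\boldsymbol X)$ by $p^d_\Diamond(\boldsymbol X,T)$, where $p^d_\Diamond$ is a new predicate and the rules $p^d_\Diamond(\boldsymbol X,T)\leftarrow p(\boldsymbol X,T-i)$, $0\le i\le d$, are added to $P'$; - $\boxplus^d\Box p(\boldsymbol X)$ by $p^d_\Box(\boldsymbol X,T)$, where $p^d_\Box$ is a new predicate and the rule $p^d_\Box(\boldsymbol X,T)\leftarrow p(\boldsymbol X,T),p(\boldsymbol X,T-1),\dots,p(\boldsymbol X,T-d)$ is added to $P'$. *)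

theory Defs
  imports Main
begin

section \<open>Atoms, literals and rules\<close>

text \<open>Objects are the elements of the type \<^typ>\<open>'o\<close>; object variables and time variables are
  numbered. Time is \<^typ>\<open>int\<close>, the time-points being the positive integers.\<close>

datatype 'o oterm = Var nat | Obj 'o

datatype ('p, 'x) atm = Atm (pred: 'p) (args: "'x list")

datatype 'b literal = Pos 'b | Neg 'b

datatype ('h, 'b) rule = Rule (head: 'h) (body: "'b literal list")

primrec oterm_inst :: "(nat \<Rightarrow> 'o) \<Rightarrow> 'o oterm \<Rightarrow> 'o" where
  "oterm_inst \<sigma> (Var v) = \<sigma> v"
| "oterm_inst \<sigma> (Obj c) = c"

abbreviation atm_inst :: "(nat \<Rightarrow> 'o) \<Rightarrow> ('p, 'o oterm) atm \<Rightarrow> ('p, 'o) atm" where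
  "atm_inst \<sigma> \<equiv> map_atm id (oterm_inst \<sigma>)"

section \<open>Evaluation of ground rules along strata\<close>

text \<open>Both semantics are instances of the following scheme: \<open>R\<close> is a set of ground rules, \<open>F\<close> a set
  of facts, \<open>sat M e\<close> says that the ground condition \<open>e\<close> is satisfied relative to \<open>M\<close>, and
  \<open>B 0, B 1, \<dots>\<close> are the strata (numbered from 0). In a stratum \<open>B\<close> above the already computed set
  \<open>L\<close>, positive conditions are evaluated relative to \<open>L \<union> X\<close> and negated ones relative to \<open>L\<close>.\<close>

definition least_stratum ::
  "('a set \<Rightarrow> 'e \<Rightarrow> bool) \<Rightarrow> ('a, 'e) rule set \<Rightarrow> 'a set \<Rightarrow> 'a set \<Rightarrow> 'a set \<Rightarrow> 'a set" where
  "least_stratum sat R F B L =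
     \<Inter> {X. X \<subseteq> B \<and> F \<inter> B \<subseteq> X \<and>
            (\<forall>r \<in> R. head r \<in> B \<longrightarrow>
               (\<forall>l \<in> set (body r). case l of Pos e \<Rightarrow> sat (L \<union> X) e | Neg e \<Rightarrow> \<not> sat L e) \<longrightarrow>
               head r \<in> X)}"

primrec strat_eval ::
  "('a set \<Rightarrow> 'e \<Rightarrow> bool) \<Rightarrow> ('a, 'e) rule set \<Rightarrow> 'a set \<Rightarrow> (nat \<Rightarrow> 'a set) \<Rightarrow> nat \<Rightarrow> 'a set" where
  "strat_eval sat R F B 0 = {}"
| "strat_eval sat R F B (Suc i) =
     strat_eval sat R F B i \<union> least_stratum sat R F (B i) (strat_eval sat R F B i)"

section \<open>Plain LARS\<close>

text \<open>Extended atoms over predicates \<^typ>\<open>'p\<close>, time terms \<^typ>\<open>'t\<close> and object terms \<^typ>\<open>'x\<close>: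
  in rules, \<^typ>\<open>'t\<close> is the type \<^typ>\<open>nat\<close> of time variables; ground extended atoms have
  \<^typ>\<open>int\<close> and \<^typ>\<open>'o\<close> instead. \<open>At\<close> is the operator \<open>@\<close>; \<open>WinAt d\<close>, \<open>WinDia d\<close>, \<open>WinBox d\<close>
  are \<open>@\<close>, diamond and box under a window of size \<open>d\<close>.\<close>

datatype ('p, 't, 'x) ext =
    Plain (atom_of: "('p, 'x) atm")
  | At 't (atom_of: "('p, 'x) atm")
  | WinAt nat 't (atom_of: "('p, 'x) atm")
  | WinDia nat (atom_of: "('p, 'x) atm")
  | WinBox nat (atom_of: "('p, 'x) atm")

type_synonym ('p, 'o) lars_rule = "(('p, 'o oterm) atm, ('p, nat, 'o oterm) ext) rule"

definition body_conds :: "('h, 'b) rule \<Rightarrow> 'b set" where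
  "body_conds r = (\<Union>l \<in> set (body r). set_literal l)"

definition time_vars :: "('p, 'o) lars_rule \<Rightarrow> nat set" where
  "time_vars r = (\<Union>e \<in> body_conds r. set2_ext e)"

fun window_positive :: "('p, 't, 'x) ext \<Rightarrow> bool" where
  "window_positive (WinAt d _ _) = (0 < d)"
| "window_positive (WinDia d _) = (0 < d)"
| "window_positive (WinBox d _) = (0 < d)"
| "window_positive _ = True"

definition has_arity :: "('p \<Rightarrow> nat) \<Rightarrow> ('p, 'x) atm \<Rightarrow> bool" where
  "has_arity ar a \<longleftrightarrow> length (args a) = ar (pred a)"

definition plain_lars_program :: "('p \<Rightarrow> nat) \<Rightarrow> ('p, 'o) lars_rule set \<Rightarrow> bool" where
  "plain_lars_program ar P \<longleftrightarrow>
     (\<forall>r \<in> P. has_arity ar (head r) \<and>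
        (\<forall>e \<in> body_conds r. has_arity ar (atom_of e) \<and> window_positive e) \<and>
        (\<forall>T' \<in> time_vars r. \<exists>d a. Pos (WinAt d T' a) \<in> set (body r)))"

definition lars_preds :: "('p, 'o) lars_rule set \<Rightarrow> 'p set" where
  "lars_preds P = (\<Union>r \<in> P. insert (pred (head r)) ((\<lambda>e. pred (atom_of e)) ` body_conds r))"

definition intensional :: "('p, 'o) lars_rule set \<Rightarrow> 'p \<Rightarrow> bool" where
  "intensional P p \<longleftrightarrow> (\<exists>r \<in> P. pred (head r) = p \<and> body r \<noteq> [])"

definition is_stream ::
  "('p \<Rightarrow> nat) \<Rightarrow> ('p, 'o) lars_rule set \<Rightarrow> (('p, 'o) atm \<times> int) set \<Rightarrow> bool" where
  "is_stream ar P S \<longleftrightarrow>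
     (\<forall>(a, t) \<in> S. 0 < t \<and> has_arity ar a \<and> \<not> intensional P (pred a))"

text \<open>\<open>st p\<close> is the index of the stratum of \<open>p\<close>. Predicates that do not occur in the program are
  placed in some stratum as well, so that the stream may mention them.\<close>

definition global_stratification ::
  "('p, 'o) lars_rule set \<Rightarrow> nat \<Rightarrow> ('p \<Rightarrow> nat) \<Rightarrow> bool" where
  "global_stratification P n st \<longleftrightarrow>
     (\<forall>p. st p < n) \<and>
     (\<forall>r \<in> P. \<forall>l \<in> set (body r).
        case l of Pos e \<Rightarrow> st (pred (atom_of e)) \<le> st (pred (head r))
                | Neg e \<Rightarrow> st (pred (atom_of e)) < st (pred (head r)))"

definition globally_stratified :: "('p, 'o) lars_rule set \<Rightarrow> bool" where
  "globally_stratified P \<longleftrightarrow> (\<exists>n st. global_stratification P n st)"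

primrec lars_sat :: "(('p, 'o) atm \<times> int) set \<Rightarrow> int \<Rightarrow> ('p, int, 'o) ext \<Rightarrow> bool" where
  "lars_sat M t (Plain a) \<longleftrightarrow> (a, t) \<in> M"
| "lars_sat M t (At t' a) \<longleftrightarrow> (a, t') \<in> M"
| "lars_sat M t (WinAt d t' a) \<longleftrightarrow> t - int d \<le> t' \<and> t' \<le> t \<and> (a, t') \<in> M"
| "lars_sat M t (WinDia d a) \<longleftrightarrow> (\<exists>s \<in> {t - int d..t}. (a, s) \<in> M)"
| "lars_sat M t (WinBox d a) \<longleftrightarrow> (\<forall>s \<in> {t - int d..t}. (a, s) \<in> M)"

text \<open>A ground instance of a rule at \<open>t\<close>: the evaluation time is attached to the head and to each
  condition.\<close>

definition lars_ground ::
  "('p, 'o) lars_rule set \<Rightarrow> (('p, 'o) atm \<times> int, int \<times> ('p, int, 'o) ext) rule set" where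
  "lars_ground P =
     {map_rule (\<lambda>a. (atm_inst \<sigma> a, t)) (\<lambda>e. (t, map_ext id \<tau> (oterm_inst \<sigma>) e)) r
       | r \<sigma> \<tau> t. r \<in> P \<and> 0 < t \<and> (\<forall>T'. 0 < \<tau> T')}"

definition lars_model ::
  "('p, 'o) lars_rule set \<Rightarrow> (('p, 'o) atm \<times> int) set \<Rightarrow> (('p, 'o) atm \<times> int) set" where
  "lars_model P S =
     (THE M. \<exists>n st. global_stratification P n st \<and>
        M = strat_eval (\<lambda>M (t, e). lars_sat M t e) (lars_ground P) S
              (\<lambda>i. {(a, t). 0 < t \<and> st (pred a) = i}) n)"

definition lars_derives ::
  "('p, 'o) lars_rule set \<Rightarrow> (('p, 'o) atm \<times> int) set \<Rightarrow> int \<Rightarrow> ('p, int, 'o) ext \<Rightarrow> bool" where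
  "lars_derives P S t e \<longleftrightarrow> lars_sat (lars_model P S) t e"

section \<open>Temporal Datalog\<close>

text \<open>The time argument is kept apart from the object arguments. The single time variable \<open>T\<close> is
  implicit: the head has time argument \<open>T\<close>, and a body atom \<open>(a, k)\<close> has time argument \<open>T - k\<close>.
  A ground atom is a pair \<open>(a, t)\<close> with time argument \<open>t\<close>.\<close>

type_synonym ('q, 'o) td_rule = "(('q, 'o oterm) atm, ('q, 'o oterm) atm \<times> int) rule"

definition td_preds :: "('q, 'o) td_rule set \<Rightarrow> 'q set" where
  "td_preds Q = (\<Union>r \<in> Q. insert (pred (head r)) ((\<lambda>(a, k). pred a) ` body_conds r))"

definition td_ground ::
  "('q, 'o) td_rule set \<Rightarrow> (('q, 'o) atm \<times> int, ('q, 'o) atm \<times> int) rule set" where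
  "td_ground Q =
     {map_rule (\<lambda>a. (atm_inst \<sigma> a, t)) (\<lambda>(a, k). (atm_inst \<sigma> a, t - k)) r
       | r \<sigma> t. r \<in> Q \<and> 0 < t}"

definition forward_propagating :: "('q, 'o) td_rule set \<Rightarrow> bool" where
  "forward_propagating Q \<longleftrightarrow> (\<forall>r \<in> Q. \<forall>(a, k) \<in> body_conds r. 0 \<le> k)"

text \<open>Stratum indices of ground atoms; expressions with a non-positive time argument are no ground
  atoms and impose no constraint.\<close>

definition local_stratification ::
  "('q, 'o) td_rule set \<Rightarrow> (('q, 'o) atm \<times> int \<Rightarrow> nat) \<Rightarrow> bool" where
  "local_stratification Q lev \<longleftrightarrow>
     (\<forall>r \<in> td_ground Q. \<forall>l \<in> set (body r).
        case l of Pos b \<Rightarrow> 0 < snd b \<longrightarrow> lev b \<le> lev (head r)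
                | Neg b \<Rightarrow> 0 < snd b \<longrightarrow> lev b < lev (head r))"

definition locally_stratified :: "('q, 'o) td_rule set \<Rightarrow> bool" where
  "locally_stratified Q \<longleftrightarrow> (\<exists>lev. local_stratification Q lev)"

definition delete_objects :: "('q, 'o) td_rule \<Rightarrow> ('q, 'o) td_rule" where
  "delete_objects = map_rule (\<lambda>a. Atm (pred a) []) (\<lambda>(a, k). (Atm (pred a) [], k))"

definition temporally_stratified :: "('q, 'o) td_rule set \<Rightarrow> bool" where
  "temporally_stratified Q \<longleftrightarrow> locally_stratified (delete_objects ` Q)"

text \<open>Arities of temporal predicates count the time argument.\<close>

definition td_program :: "('q \<Rightarrow> nat) \<Rightarrow> ('q, 'o) td_rule set \<Rightarrow> bool" where
  "td_program ar Q \<longleftrightarrow>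
     (\<forall>r \<in> Q. length (args (head r)) + 1 = ar (pred (head r)) \<and>
        (\<forall>(a, k) \<in> body_conds r. length (args a) + 1 = ar (pred a))) \<and>
     forward_propagating Q \<and> temporally_stratified Q"

text \<open>The strata contain positive times only, so atoms with non-positive time are false.\<close>

definition perfect_model ::
  "('q, 'o) td_rule set \<Rightarrow> (('q, 'o) atm \<times> int) set \<Rightarrow> (('q, 'o) atm \<times> int) set" where
  "perfect_model Q F =
     (THE I. \<exists>lev. local_stratification Q lev \<and>
        I = (\<Union>i. strat_eval (\<lambda>M b. b \<in> M) (td_ground Q) F
                    (\<lambda>i. {(a, t). 0 < t \<and> lev (a, t) = i}) i))"

section \<open>The translation\<close>

text \<open>\<open>Bot\<close> is a predicate with a time argument only; it occurs in no head and in no stream.\<close>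

datatype 'p tdpred = Orig 'p | DiaP 'p nat | BoxP 'p nat | Bot

primrec td_arity :: "('p \<Rightarrow> nat) \<Rightarrow> 'p tdpred \<Rightarrow> nat" where
  "td_arity ar (Orig p) = ar p + 1"
| "td_arity ar (DiaP p d) = ar p + 1"
| "td_arity ar (BoxP p d) = ar p + 1"
| "td_arity ar Bot = 1"

fun first_window :: "nat \<Rightarrow> ('p, nat, 'x) ext literal list \<Rightarrow> nat" where
  "first_window T' [] = 0"
| "first_window T' (Pos (WinAt d U a) # ls) = (if U = T' then d else first_window T' ls)"
| "first_window T' (_ # ls) = first_window T' ls"

text \<open>Below, \<open>\<mu> T' = i\<close> stands for mapping \<open>T'\<close> to \<open>T - i\<close>.\<close>

primrec tr_cond ::
  "(nat \<Rightarrow> nat) \<Rightarrow> ('p, nat, 'o oterm) ext \<Rightarrow> ('p tdpred, 'o oterm) atm \<times> int" where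
  "tr_cond \<mu> (Plain a) = (Atm (Orig (pred a)) (args a), 0)"
| "tr_cond \<mu> (At T' a) = (Atm (Orig (pred a)) (args a), int (\<mu> T'))"
| "tr_cond \<mu> (WinAt d T' a) =
     (if \<mu> T' \<le> d then (Atm (Orig (pred a)) (args a), int (\<mu> T')) else (Atm Bot [], 0))"
| "tr_cond \<mu> (WinDia d a) = (Atm (DiaP (pred a) d) (args a), 0)"
| "tr_cond \<mu> (WinBox d a) = (Atm (BoxP (pred a) d) (args a), 0)"

definition tr_rule :: "(nat \<Rightarrow> nat) \<Rightarrow> ('p, 'o) lars_rule \<Rightarrow> ('p tdpred, 'o) td_rule" where
  "tr_rule \<mu> = map_rule (\<lambda>a. Atm (Orig (pred a)) (args a)) (tr_cond \<mu>)"

text \<open>In the rules defining an auxiliary predicate the object tuple consists of distinct variables,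
  so that the predicate is defined for all objects, whatever terms occur in the translated
  condition.\<close>

definition var_tuple :: "nat \<Rightarrow> 'o oterm list" where
  "var_tuple n = map Var [0..<n]"

fun aux_rules :: "('p \<Rightarrow> nat) \<Rightarrow> ('p, nat, 'o oterm) ext \<Rightarrow> ('p tdpred, 'o) td_rule set" where
  "aux_rules ar (WinDia d (Atm p _)) =
     {Rule (Atm (DiaP p d) (var_tuple (ar p)))
           [Pos (Atm (Orig p) (var_tuple (ar p)), int i)] | i. i \<le> d}"
| "aux_rules ar (WinBox d (Atm p _)) =
     {Rule (Atm (BoxP p d) (var_tuple (ar p)))
           (map (\<lambda>i. Pos (Atm (Orig p) (var_tuple (ar p)), int i)) [0..<d + 1])}"
| "aux_rules ar _ = {}"

definition pLARS2TD ::
  "('p \<Rightarrow> nat) \<Rightarrow> ('p, 'o) lars_rule set \<Rightarrow> ('p tdpred, 'o) td_rule set" where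
  "pLARS2TD ar P =
     (\<Union>r \<in> P. {tr_rule \<mu> r | \<mu>. \<forall>T' \<in> time_vars r. \<mu> T' \<le> first_window T' (body r)} \<union>
               (\<Union>e \<in> body_conds r. aux_rules ar e))"

definition stream_facts :: "(('p, 'o) atm \<times> int) set \<Rightarrow> (('p tdpred, 'o) atm \<times> int) set" where
  "stream_facts S = (\<lambda>(a, s). (map_atm Orig id a, s)) ` S"

end

(* Stratified evaluation yields a stable model, i.e. the least set closed under the reduct of the
   rules by that set, and a stratified set of rules has only one stable model, whatever stratification
   is used. This makes both semantics independent of the stratification, and it remains to check that
   the stable model of the LARS program, extended by the intended meaning of the auxiliary
   predicates, is stable for the translated program. *)

theory Submission
  imports Defs
begin

section \<open>Stable models and stratified evaluation\<close>

text \<open>Each model is a \<open>THE\<close> over all stratifications, so uniqueness across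
  stratifications is part of the claim; moreover, LARS strata are finitely many sets of predicates,
  whereas a local stratification may separate ground atoms in any way, so comparing stages directly
  is hopeless. In the reduct the negated conditions are frozen at the candidate set itself, so the
  two programs can be compared without mentioning strata. Two mismatches remain. LARS instances
  choose positive values \<open>\<tau>\<close> for time variables, temporal rules choose offsets
  \<open>\<mu>\<close>. The positive window condition required for every time variable makes
  \<open>\<tau> T' = t - int (\<mu> T')\<close> a correspondence between instances whose positive
  bodies hold. Auxiliary atoms have no LARS counterpart, but their rules are positive with bodies of
  original atoms only, so their extension is a monotone function of the original part.\<close>

definition body_holds ::
  "('a set \<Rightarrow> 'e \<Rightarrow> bool) \<Rightarrow> 'a set \<Rightarrow> 'a set \<Rightarrow> ('h, 'e) rule \<Rightarrow> bool" where
  "body_holds sat X N r \<longleftrightarrow>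
     (\<forall>e. Pos e \<in> set (body r) \<longrightarrow> sat X e) \<and> (\<forall>e. Neg e \<in> set (body r) \<longrightarrow> \<not> sat N e)"

lemma literals_hold_iff_body_holds:
  "(\<forall>l \<in> set (body r). case l of Pos e \<Rightarrow> sat X e | Neg e \<Rightarrow> \<not> sat N e) \<longleftrightarrow>
     body_holds sat X N r"
  unfolding body_holds_def by (auto split: literal.splits)

section \<open>Bodies of rules under maps of heads and conditions\<close>

lemma map_literal_eq_iff:
  "map_literal g l = Pos e \<longleftrightarrow> (\<exists>e'. l = Pos e' \<and> e = g e')"
  "map_literal g l = Neg e \<longleftrightarrow> (\<exists>e'. l = Neg e' \<and> e = g e')"
  by (cases l; auto)+

lemma Pos_in_body_map_rule:
  "Pos e \<in> set (body (map_rule f g r)) \<longleftrightarrow> (\<exists>e'. e = g e' \<and> Pos e' \<in> set (body r))"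
  by (simp add: rule.map_sel image_iff eq_commute[of "Pos e"] map_literal_eq_iff) blast

lemma Neg_in_body_map_rule:
  "Neg e \<in> set (body (map_rule f g r)) \<longleftrightarrow> (\<exists>e'. e = g e' \<and> Neg e' \<in> set (body r))"
  by (simp add: rule.map_sel image_iff eq_commute[of "Neg e"] map_literal_eq_iff) blast

lemma body_holds_map_rule:
  "body_holds sat X N (map_rule f g r) \<longleftrightarrow>
     (\<forall>e. Pos e \<in> set (body r) \<longrightarrow> sat X (g e)) \<and> (\<forall>e. Neg e \<in> set (body r) \<longrightarrow> \<not> sat N (g e))"
  unfolding body_holds_def Pos_in_body_map_rule Neg_in_body_map_rule by blast

lemma body_conds_iff: "e \<in> body_conds r \<longleftrightarrow> Pos e \<in> set (body r) \<or> Neg e \<in> set (body r)"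
proof -
  have "e \<in> set_literal l \<longleftrightarrow> l = Pos e \<or> l = Neg e" for l
    by (cases l) auto
  then show ?thesis unfolding body_conds_def by auto
qed

text \<open>Closure under the Gelfond-Lifschitz reduct by \<open>N\<close>, without building the
  reduct: negated conditions are read in the fixed \<open>N\<close>, positive ones in
  \<open>X\<close>. \<open>D\<close> is the universe, later the pairs with positive time; facts and
  heads outside it are ignored.\<close>

definition reduct_closed ::
  "('a set \<Rightarrow> 'e \<Rightarrow> bool) \<Rightarrow> ('a, 'e) rule set \<Rightarrow> 'a set \<Rightarrow> 'a set \<Rightarrow> 'a set \<Rightarrow> 'a set \<Rightarrow> bool"
where
  "reduct_closed sat R F D N X \<longleftrightarrow> X \<subseteq> D \<and> F \<inter> D \<subseteq> X \<and>
     (\<forall>r \<in> R. head r \<in> D \<longrightarrow> body_holds sat X N r \<longrightarrow> head r \<in> X)"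

lemma reduct_closedD:
  assumes "reduct_closed sat R F D N X"
  shows "X \<subseteq> D" and "F \<inter> D \<subseteq> X"
    and "r \<in> R \<Longrightarrow> body_holds sat X N r \<Longrightarrow> head r \<in> D \<Longrightarrow> head r \<in> X"
  using assms unfolding reduct_closed_def by blast+

definition stable ::
  "('a set \<Rightarrow> 'e \<Rightarrow> bool) \<Rightarrow> ('a, 'e) rule set \<Rightarrow> 'a set \<Rightarrow> 'a set \<Rightarrow> 'a set \<Rightarrow> bool" where
  "stable sat R F D N \<longleftrightarrow>
     reduct_closed sat R F D N N \<and> (\<forall>X. reduct_closed sat R F D N X \<longrightarrow> N \<subseteq> X)"

lemma stableD:
  assumes "stable sat R F D N"
  shows "reduct_closed sat R F D N N" and "reduct_closed sat R F D N X \<Longrightarrow> N \<subseteq> X"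
  using assms unfolding stable_def by blast+

text \<open>A diamond or box condition inspects several atoms, so its level is expressed through
  \<open>sat\<close>: truth survives the deletion of all atoms above the level of the head, and for
  negated conditions also of those at that level. The premise \<open>X \<subseteq> D\<close> keeps
  out atoms with non-positive time, on which a local stratification imposes nothing.\<close>

locale stratified_rules =
  fixes sat :: "'a set \<Rightarrow> 'e \<Rightarrow> bool"
    and R :: "('a, 'e) rule set"
    and D :: "'a set"
    and lev :: "'a \<Rightarrow> nat"
  assumes sat_mono: "X \<subseteq> Y \<Longrightarrow> sat X e \<Longrightarrow> sat Y e"
    and sat_Pos: "r \<in> R \<Longrightarrow> head r \<in> D \<Longrightarrow> Pos e \<in> set (body r) \<Longrightarrow> X \<subseteq> D \<Longrightarrow> sat X e \<Longrightarrow>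
      sat {a \<in> X. lev a \<le> lev (head r)} e"
    and sat_Neg: "r \<in> R \<Longrightarrow> head r \<in> D \<Longrightarrow> Neg e \<in> set (body r) \<Longrightarrow> X \<subseteq> D \<Longrightarrow> sat X e \<Longrightarrow>
      sat {a \<in> X. lev a < lev (head r)} e"
begin

definition stratum :: "nat \<Rightarrow> 'a set" where
  "stratum i = {a \<in> D. lev a = i}"

lemma in_stratum: "a \<in> stratum i \<longleftrightarrow> a \<in> D \<and> lev a = i"
  by (simp add: stratum_def)

abbreviation "E F \<equiv> strat_eval sat R F stratum"

definition total :: "'a set \<Rightarrow> 'a set" where
  "total F = (\<Union>i. E F i)"

lemma body_holds_mono: "X \<subseteq> Y \<Longrightarrow> N' \<subseteq> N \<Longrightarrow> body_holds sat X N r \<Longrightarrow> body_holds sat Y N' r"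
  unfolding body_holds_def using sat_mono by blast

section \<open>The least set of a single stratum\<close>

lemma least_stratum_altdef:
  "least_stratum sat R F B L =
     \<Inter> {X. X \<subseteq> B \<and> F \<inter> B \<subseteq> X \<and>
            (\<forall>r \<in> R. head r \<in> B \<longrightarrow> body_holds sat (L \<union> X) L r \<longrightarrow> head r \<in> X)}"
  unfolding least_stratum_def literals_hold_iff_body_holds ..

lemma least_stratum_subset: "least_stratum sat R F B L \<subseteq> B"
  unfolding least_stratum_altdef by blast

lemma facts_subset_least_stratum: "F \<inter> B \<subseteq> least_stratum sat R F B L"
  unfolding least_stratum_altdef by blast

text \<open>Closure survives the intersection because positive conditions are monotone: a body that
  holds over the intersection holds over each of its members.\<close>

lemma least_stratum_closed:
  assumes "r \<in> R" "head r \<in> B" "body_holds sat (L \<union> least_stratum sat R F B L) L r"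
  shows "head r \<in> least_stratum sat R F B L"
  unfolding least_stratum_altdef
proof (rule InterI)
  fix X assume X: "X \<in> {X. X \<subseteq> B \<and> F \<inter> B \<subseteq> X \<and>
    (\<forall>r \<in> R. head r \<in> B \<longrightarrow> body_holds sat (L \<union> X) L r \<longrightarrow> head r \<in> X)}"
  then have "least_stratum sat R F B L \<subseteq> X"
    unfolding least_stratum_altdef by (rule Inter_lower)
  then have "body_holds sat (L \<union> X) L r"
    using body_holds_mono assms(3) by (meson Un_mono order_refl)
  with X assms(1,2) show "head r \<in> X" by blast
qed

lemma least_stratum_least:
  assumes "X \<subseteq> B" "F \<inter> B \<subseteq> X"
    and "\<And>r. r \<in> R \<Longrightarrow> head r \<in> B \<Longrightarrow> body_holds sat (L \<union> X) L r \<Longrightarrow> head r \<in> X"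
  shows "least_stratum sat R F B L \<subseteq> X"
  unfolding least_stratum_altdef using assms by (intro Inter_lower) blast

text \<open>The only place where the level assumptions enter. The inclusions for \<open>X'\<close>
  and \<open>N'\<close> run in opposite directions: positive conditions must stay true in
  \<open>X'\<close>, while a negated condition true in \<open>N'\<close> would already be true in
  \<open>N\<close>.\<close>

lemma body_holds_restrict:
  assumes r: "r \<in> R" "head r \<in> D" and X: "X \<subseteq> D" and holds: "body_holds sat X N r"
    and X': "{a \<in> X. lev a \<le> lev (head r)} \<subseteq> X'"
    and N': "N' \<subseteq> D" "{a \<in> N'. lev a < lev (head r)} \<subseteq> N"
  shows "body_holds sat X' N' r"
  unfolding body_holds_def
proof safe
  fix e assume e: "Pos e \<in> set (body r)"
  then have "sat X e" using holds unfolding body_holds_def by blast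
  then show "sat X' e" using sat_Pos[OF r e X] sat_mono[OF X'] by blast
next
  fix e assume e: "Neg e \<in> set (body r)" "sat N' e"
  then have "sat N e" using sat_Neg[OF r e(1) N'(1)] sat_mono[OF N'(2)] by blast
  then show False using holds e(1) unfolding body_holds_def by blast
qed

section \<open>Stages as truncations of the union of all strata\<close>

lemma E_le: "E F i \<subseteq> {a \<in> D. lev a < i}"
proof (induction i)
  case (Suc i)
  then show ?case
    using least_stratum_subset[of F "stratum i" "E F i"] by (auto simp: in_stratum less_Suc_eq)
qed simp

lemma E_mono: "i \<le> j \<Longrightarrow> E F i \<subseteq> E F j"
  by (rule lift_Suc_mono_le[of "E F"]) auto

text \<open>Stage \<open>j\<close> adds only atoms of level \<open>j\<close>, so nothing below level
  \<open>i\<close> changes from stage \<open>i\<close> on.\<close>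

lemma E_restrict: "i \<le> j \<Longrightarrow> {a \<in> E F j. lev a < i} = E F i"
proof (induction j rule: dec_induct)
  case base
  then show ?case using E_le by blast
next
  case (step j)
  have "{a \<in> least_stratum sat R F (stratum j) (E F j). lev a < i} = {}"
    using least_stratum_subset[of F "stratum j" "E F j"] step.hyps by (auto simp: in_stratum)
  then show ?case using step.IH by auto
qed

lemma E_eq: "E F i = {a \<in> total F. lev a < i}"
proof -
  have "a \<in> E F i" if "a \<in> E F j" "lev a < i" for a j
    using that E_mono[of j i F] E_restrict[of i j F] by (cases "j \<le> i") auto
  then show ?thesis unfolding total_def using E_le by blast
qed

lemma total_subset: "total F \<subseteq> D"
  unfolding total_def using E_le by blast

text \<open>A rule firing in \<open>total F\<close> already fires in the stratum of its head, since
  its body looks no higher than that stratum. Minimality is an induction over the stages.\<close>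

lemma stable_total: "stable sat R F D (total F)"
  unfolding stable_def
proof (intro conjI allI impI)
  have LS: "least_stratum sat R F (stratum i) (E F i) \<subseteq> total F" for i
    unfolding total_def using strat_eval.simps(2)[of sat R F stratum i] by blast
  show "reduct_closed sat R F D (total F) (total F)"
    unfolding reduct_closed_def
  proof (intro conjI ballI impI)
    show "total F \<subseteq> D" by (rule total_subset)
    show "F \<inter> D \<subseteq> total F"
    proof
      fix a assume "a \<in> F \<inter> D"
      then have "a \<in> F \<inter> stratum (lev a)" by (simp add: in_stratum)
      then show "a \<in> total F" using LS facts_subset_least_stratum by blast
    qed
    fix r assume r: "r \<in> R" "head r \<in> D" and holds: "body_holds sat (total F) (total F) r"
    let ?i = "lev (head r)"
    have "{a \<in> total F. lev a \<le> ?i} \<subseteq> E F ?i \<union> least_stratum sat R F (stratum ?i) (E F ?i)"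
      using E_eq[of F "Suc ?i"] by (auto simp: less_Suc_eq_le)
    moreover have "E F ?i \<subseteq> D" "{a \<in> E F ?i. lev a < ?i} \<subseteq> total F"
      using E_le E_eq by blast+
    ultimately have
      "body_holds sat (E F ?i \<union> least_stratum sat R F (stratum ?i) (E F ?i)) (E F ?i) r"
      using body_holds_restrict[OF r total_subset holds] by blast
    moreover have "head r \<in> stratum ?i" using r by (simp add: in_stratum)
    ultimately show "head r \<in> total F" using least_stratum_closed r(1) LS by blast
  qed
next
  fix X assume X: "reduct_closed sat R F D (total F) X"
  have "E F i \<subseteq> X" for i
  proof (induction i)
    case (Suc i)
    have "least_stratum sat R F (stratum i) (E F i) \<subseteq> X \<inter> stratum i"
    proof (rule least_stratum_least)
      show "F \<inter> stratum i \<subseteq> X \<inter> stratum i"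
        using X by (auto simp: reduct_closed_def in_stratum)
      fix r assume r: "r \<in> R" "head r \<in> stratum i"
        and "body_holds sat (E F i \<union> X \<inter> stratum i) (E F i) r"
      then have holds: "body_holds sat X (E F i) r"
        using Suc.IH by (elim body_holds_mono[rotated 2]) auto
      \<comment> \<open>The reduct is taken by \<open>total F\<close>, but the stratum saw only
        \<open>E F i\<close>. For a head of level \<open>i\<close> negated conditions look strictly
        below \<open>i\<close>, where the two agree.\<close>
      have "body_holds sat X (total F) r"
      proof (rule body_holds_restrict[OF r(1) _ _ holds])
        show "{a \<in> total F. lev a < lev (head r)} \<subseteq> E F i"
          unfolding E_eq using r(2) by (simp add: in_stratum)
      qed (use r X total_subset in \<open>auto simp: in_stratum reduct_closed_def\<close>)
      then show "head r \<in> X \<inter> stratum i"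
        using X r by (auto simp: reduct_closed_def in_stratum)
    qed simp
    then show ?case using Suc.IH by simp
  qed simp
  then show "total F \<subseteq> X" unfolding total_def by blast
qed

text \<open>By induction, \<open>N\<close> truncated below level \<open>i\<close> is stage
  \<open>i\<close>. In stratum \<open>i\<close>, closure of \<open>N\<close> gives one inclusion and
  minimality of \<open>N\<close> the other.\<close>

lemma stable_unique:
  assumes N: "stable sat R F D N"
  shows "N = total F"
proof -
  have N1: "N \<subseteq> D" "F \<inter> D \<subseteq> N"
    and N2: "\<And>r. r \<in> R \<Longrightarrow> head r \<in> D \<Longrightarrow> body_holds sat N N r \<Longrightarrow> head r \<in> N"
    and N3: "\<And>X. reduct_closed sat R F D N X \<Longrightarrow> N \<subseteq> X"
    using N unfolding stable_def reduct_closed_def by blast+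
  have eq: "E F i = {a \<in> N. lev a < i}" for i
  proof (induction i)
    case (Suc i)
    let ?LS = "least_stratum sat R F (stratum i) (E F i)"
    have sub: "?LS \<subseteq> N \<inter> stratum i"
    proof (rule least_stratum_least)
      show "F \<inter> stratum i \<subseteq> N \<inter> stratum i" using N1 by (auto simp: in_stratum)
      fix r assume r: "r \<in> R" "head r \<in> stratum i"
        and holds: "body_holds sat (E F i \<union> N \<inter> stratum i) (E F i) r"
      have "body_holds sat N N r"
        by (rule body_holds_restrict[OF r(1) _ _ holds]) (use r N1 Suc.IH in \<open>auto simp: in_stratum\<close>)
      then show "head r \<in> N \<inter> stratum i" using N2 r by (auto simp: in_stratum)
    qed simp
    \<comment> \<open>Minimality of \<open>N\<close> speaks about sets closed in all strata, so only
      the slice of \<open>N\<close> at level \<open>i\<close> is exchanged. Rules with heads at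
      other levels cause no trouble: \<open>?X \<subseteq> N\<close>, so whatever fires in
      \<open>?X\<close> fires in \<open>N\<close>, and its head stays in
      \<open>N - stratum i\<close>.\<close>
    let ?X = "(N - stratum i) \<union> ?LS"
    have "reduct_closed sat R F D N ?X"
      unfolding reduct_closed_def
    proof (intro conjI ballI impI)
      show "?X \<subseteq> D" using N1 sub by blast
      show "F \<inter> D \<subseteq> ?X" using N1 facts_subset_least_stratum[of F "stratum i" "E F i"] by blast
      fix r assume r: "r \<in> R" "head r \<in> D" and holds: "body_holds sat ?X N r"
      show "head r \<in> ?X"
      proof (cases "head r \<in> stratum i")
        case True
        have "body_holds sat (E F i \<union> ?LS) (E F i) r"
          by (rule body_holds_restrict[OF r _ holds])
            (use True N1 Suc.IH sub in \<open>auto simp: in_stratum\<close>)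
        then show ?thesis using least_stratum_closed[OF r(1) True] by blast
      next
        case False
        have "body_holds sat N N r" using body_holds_mono[OF _ _ holds] sub by blast
        then show ?thesis using N2[OF r] False by blast
      qed
    qed
    then have "N \<inter> stratum i \<subseteq> ?LS" using N3 by blast
    with sub have LS: "?LS = N \<inter> stratum i" by blast
    have "E F (Suc i) = {a \<in> N. lev a < i} \<union> (N \<inter> stratum i)"
      unfolding strat_eval.simps(2) LS unfolding Suc.IH ..
    then show ?case using N1 by (auto simp: in_stratum less_Suc_eq)
  qed simp
  show ?thesis unfolding total_def eq by auto
qed

end

section \<open>Independence of the stratification\<close>

abbreviation timed :: "('x \<times> int) set" where
  "timed \<equiv> {(a, t). 0 < t}"

abbreviation lars_cond_sat ::
  "(('p, 'o) atm \<times> int) set \<Rightarrow> int \<times> ('p, int, 'o) ext \<Rightarrow> bool" where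
  "lars_cond_sat \<equiv> \<lambda>M (t, e). lars_sat M t e"

abbreviation lars_stable ::
  "('p, 'o) lars_rule set \<Rightarrow> (('p, 'o) atm \<times> int) set \<Rightarrow> (('p, 'o) atm \<times> int) set \<Rightarrow> bool" where
  "lars_stable P S M \<equiv> stable lars_cond_sat (lars_ground P) S timed M"

abbreviation td_stable ::
  "('q, 'o) td_rule set \<Rightarrow> (('q, 'o) atm \<times> int) set \<Rightarrow> (('q, 'o) atm \<times> int) set \<Rightarrow> bool" where
  "td_stable Q F I \<equiv> stable (\<lambda>M b. b \<in> M) (td_ground Q) F timed I"

lemma lars_sat_mono: "X \<subseteq> Y \<Longrightarrow> lars_sat X t e \<Longrightarrow> lars_sat Y t e"
  by (cases e) auto

text \<open>However many time-points a window covers, a condition only asks about one atom, so pairs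
  with other predicates may be deleted. Levels by predicate are therefore adequate for
  windows.\<close>

lemma lars_sat_restrict_pred:
  "lars_sat X t e \<Longrightarrow> Q (pred (atom_of e)) \<Longrightarrow> lars_sat {b \<in> X. Q (pred (fst b))} t e"
  by (cases e) auto

lemma pred_atom_of_map_ext: "pred (atom_of (map_ext id f g e)) = pred (atom_of e)"
  by (cases e) (auto simp: atm.map_sel)

lemma global_stratification_Pos:
  "global_stratification P n st \<Longrightarrow> r \<in> P \<Longrightarrow> Pos e \<in> set (body r) \<Longrightarrow>
     st (pred (atom_of e)) \<le> st (pred (head r))"
  unfolding global_stratification_def by force

lemma global_stratification_Neg:
  "global_stratification P n st \<Longrightarrow> r \<in> P \<Longrightarrow> Neg e \<in> set (body r) \<Longrightarrow>
     st (pred (atom_of e)) < st (pred (head r))"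
  unfolding global_stratification_def by force

lemma stratified_rules_lars:
  fixes P :: "('p, 'o) lars_rule set"
  assumes "global_stratification P n st"
  shows "stratified_rules lars_cond_sat (lars_ground P) timed (\<lambda>b. st (pred (fst b)))"
proof
  fix X Y :: "(('p, 'o) atm \<times> int) set" and e :: "int \<times> ('p, int, 'o) ext"
  assume "X \<subseteq> Y" "lars_cond_sat X e"
  then show "lars_cond_sat Y e" using lars_sat_mono by (auto split: prod.splits)
next
  fix r :: "(('p, 'o) atm \<times> int, int \<times> ('p, int, 'o) ext) rule" and e and X :: "(('p, 'o) atm \<times> int) set"
  assume r: "r \<in> lars_ground P" and e: "Pos e \<in> set (body r)" and "lars_cond_sat X e"
  moreover have "st (pred (atom_of (snd e))) \<le> st (pred (fst (head r)))"
    using r e global_stratification_Pos[OF assms]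
    by (auto simp: lars_ground_def Pos_in_body_map_rule rule.map_sel(1) atm.map_sel
      pred_atom_of_map_ext)
  ultimately show "lars_cond_sat {b \<in> X. st (pred (fst b)) \<le> st (pred (fst (head r)))} e"
    using lars_sat_restrict_pred[of X "fst e" "snd e" "\<lambda>p. st p \<le> st (pred (fst (head r)))"]
    by (auto simp: case_prod_beta)
next
  fix r :: "(('p, 'o) atm \<times> int, int \<times> ('p, int, 'o) ext) rule" and e and X :: "(('p, 'o) atm \<times> int) set"
  assume r: "r \<in> lars_ground P" and e: "Neg e \<in> set (body r)" and "lars_cond_sat X e"
  moreover have "st (pred (atom_of (snd e))) < st (pred (fst (head r)))"
    using r e global_stratification_Neg[OF assms]
    by (auto simp: lars_ground_def Neg_in_body_map_rule rule.map_sel(1) atm.map_sel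
      pred_atom_of_map_ext)
  ultimately show "lars_cond_sat {b \<in> X. st (pred (fst b)) < st (pred (fst (head r)))} e"
    using lars_sat_restrict_pred[of X "fst e" "snd e" "\<lambda>p. st p < st (pred (fst (head r)))"]
    by (auto simp: case_prod_beta)
qed

text \<open>The restriction to subsets of \<open>timed\<close> supplies the positivity under which
  \<open>local_stratification\<close> constrains levels.\<close>

lemma stratified_rules_td:
  assumes "local_stratification Q lev"
  shows "stratified_rules (\<lambda>M b. b \<in> M) (td_ground Q) timed lev"
  by unfold_locales (use assms in \<open>fastforce simp: local_stratification_def\<close>)+

lemma lars_stable_lars_model:
  assumes "globally_stratified P"
  shows "lars_stable P S (lars_model P S)"
proof -
  define \<M> where "\<M> = (\<lambda>n st. strat_eval lars_cond_sat (lars_ground P) S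
    (\<lambda>i. {(a, t). 0 < t \<and> st (pred a) = i}) n)"
  have stable: "lars_stable P S (\<M> n st)"
    and unique: "lars_stable P S N \<Longrightarrow> N = \<M> n st"
    if st: "global_stratification P n st" for n st N
  proof -
    interpret stratified_rules lars_cond_sat "lars_ground P" timed "\<lambda>b. st (pred (fst b))"
      using st by (rule stratified_rules_lars)
    have "\<M> n st = E S n" unfolding \<M>_def
      by (rule arg_cong[of _ _ "\<lambda>B. strat_eval _ _ _ B n"]) (auto simp: stratum_def)
    \<comment> \<open>All values of \<open>st\<close> lie below \<open>n\<close>, so stage
      \<open>n\<close> exhausts the union.\<close>
    also have "\<dots> = total S" using st E_eq[of S n] by (auto simp: global_stratification_def)
    finally have eq: "\<M> n st = total S" .
    show "lars_stable P S (\<M> n st)" unfolding eq by (rule stable_total)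
    show "lars_stable P S N \<Longrightarrow> N = \<M> n st" unfolding eq by (rule stable_unique)
  qed
  obtain n st where st: "global_stratification P n st"
    using assms unfolding globally_stratified_def by blast
  have "lars_model P S = (THE M. \<exists>n st. global_stratification P n st \<and> M = \<M> n st)"
    by (simp add: lars_model_def \<M>_def)
  also have "\<dots> = \<M> n st"
    using st stable unique by (intro the_equality) blast+
  finally have "lars_model P S = \<M> n st" .
  then show ?thesis using stable[OF st] by simp
qed

text \<open>Every local stratification evaluates to the unique stable set. Hence a stable
  \<open>I\<close> found by other means is the perfect model, once some local stratification
  exists.\<close>

lemma perfect_model_eqI:
  assumes "local_stratification Q lev" and "td_stable Q F I"
  shows "perfect_model Q F = I"
proof -
  have total: "(\<Union>i. strat_eval (\<lambda>M b. b \<in> M) (td_ground Q) F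
      (\<lambda>i. {(a, t). 0 < t \<and> lev (a, t) = i}) i) = I"
    if "local_stratification Q lev" for lev
  proof -
    interpret stratified_rules "\<lambda>M b. b \<in> M" "td_ground Q" timed lev
      using that by (rule stratified_rules_td)
    have "stratum = (\<lambda>i. {(a, t). 0 < t \<and> lev (a, t) = i})"
      by (auto simp: stratum_def)
    then show ?thesis using stable_unique[OF assms(2)] by (simp add: total_def)
  qed
  show ?thesis unfolding perfect_model_def
    using assms(1) total by (intro the_equality) blast+
qed

section \<open>The translated program\<close>

lemma pLARS2TD_cases [consumes 1, case_names rule dia box]:
  assumes "r' \<in> pLARS2TD ar P"
  obtains r \<mu> where "r \<in> P" "\<forall>T' \<in> time_vars r. \<mu> T' \<le> first_window T' (body r)"
      "r' = tr_rule \<mu> r"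
  | r d p xs i where "r \<in> P" "WinDia d (Atm p xs) \<in> body_conds r" "i \<le> d"
      "r' = Rule (Atm (DiaP p d) (var_tuple (ar p)))
           [Pos (Atm (Orig p) (var_tuple (ar p)), int i)]"
  | r d p xs where "r \<in> P" "WinBox d (Atm p xs) \<in> body_conds r"
      "r' = Rule (Atm (BoxP p d) (var_tuple (ar p)))
           (map (\<lambda>i. Pos (Atm (Orig p) (var_tuple (ar p)), int i)) [0..<d + 1])"
proof -
  from assms obtain r where r: "r \<in> P"
    and "(\<exists>\<mu>. r' = tr_rule \<mu> r \<and> (\<forall>T' \<in> time_vars r. \<mu> T' \<le> first_window T' (body r))) \<or>
      (\<exists>e \<in> body_conds r. r' \<in> aux_rules ar e)"
    unfolding pLARS2TD_def by blast
  then consider \<mu> where "r' = tr_rule \<mu> r" "\<forall>T' \<in> time_vars r. \<mu> T' \<le> first_window T' (body r)"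
    | e where "e \<in> body_conds r" "r' \<in> aux_rules ar e" by blast
  then show thesis
  proof cases
    case 1
    then show thesis using that(1) r by blast
  next
    case 2
    then show thesis using that(2,3) r by (cases "(ar, e)" rule: aux_rules.cases) auto
  qed
qed

lemma tr_rule_in_pLARS2TD:
  "r \<in> P \<Longrightarrow> \<forall>T' \<in> time_vars r. \<mu> T' \<le> first_window T' (body r) \<Longrightarrow> tr_rule \<mu> r \<in> pLARS2TD ar P"
  unfolding pLARS2TD_def by blast

lemma dia_rule_in_pLARS2TD:
  "r \<in> P \<Longrightarrow> WinDia d (Atm p xs) \<in> body_conds r \<Longrightarrow> i \<le> d \<Longrightarrow>
     Rule (Atm (DiaP p d) (var_tuple (ar p))) [Pos (Atm (Orig p) (var_tuple (ar p)), int i)]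
       \<in> pLARS2TD ar P"
  unfolding pLARS2TD_def by fastforce

lemma box_rule_in_pLARS2TD:
  "r \<in> P \<Longrightarrow> WinBox d (Atm p xs) \<in> body_conds r \<Longrightarrow>
     Rule (Atm (BoxP p d) (var_tuple (ar p)))
       (map (\<lambda>i. Pos (Atm (Orig p) (var_tuple (ar p)), int i)) [0..<d + 1]) \<in> pLARS2TD ar P"
  unfolding pLARS2TD_def by (rule UN_I, assumption, rule UnI2, rule UN_I, assumption) simp

lemma Pos_in_body_tr_rule:
  "Pos b \<in> set (body (tr_rule \<mu> r)) \<longleftrightarrow> (\<exists>e. b = tr_cond \<mu> e \<and> Pos e \<in> set (body r))"
  unfolding tr_rule_def by (rule Pos_in_body_map_rule)

lemma Neg_in_body_tr_rule:
  "Neg b \<in> set (body (tr_rule \<mu> r)) \<longleftrightarrow> (\<exists>e. b = tr_cond \<mu> e \<and> Neg e \<in> set (body r))"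
  unfolding tr_rule_def by (rule Neg_in_body_map_rule)

lemma head_tr_rule: "head (tr_rule \<mu> r) = Atm (Orig (pred (head r))) (args (head r))"
  by (simp add: tr_rule_def rule.map_sel(1))

lemma length_var_tuple [simp]: "length (var_tuple n) = n"
  by (simp add: var_tuple_def)

section \<open>Temporal stratification of the translated program\<close>

text \<open>\<open>Bot\<close> may occur negated, so it lies strictly below everything else.\<close>

fun td_level :: "('p \<Rightarrow> nat) \<Rightarrow> 'p tdpred \<Rightarrow> nat" where
  "td_level st (Orig p) = Suc (st p)"
| "td_level st (DiaP p d) = Suc (st p)"
| "td_level st (BoxP p d) = Suc (st p)"
| "td_level st Bot = 0"

text \<open>Levels that ignore objects and time altogether. They survive grounding as well as the
  deletion of object terms, so one function per program yields both local and temporal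
  stratification.\<close>

definition pred_stratification :: "('q, 'o) td_rule set \<Rightarrow> ('q \<Rightarrow> nat) \<Rightarrow> bool" where
  "pred_stratification Q L \<longleftrightarrow> (\<forall>r \<in> Q.
     (\<forall>b. Pos b \<in> set (body r) \<longrightarrow> L (pred (fst b)) \<le> L (pred (head r))) \<and>
     (\<forall>b. Neg b \<in> set (body r) \<longrightarrow> L (pred (fst b)) < L (pred (head r))))"

text \<open>Grounding and deletion of object terms are both maps on heads and conditions that keep
  predicate levels; \<open>pred'\<close> and \<open>pred''\<close> abstract how the predicate is
  read off in the image.\<close>

lemma pred_stratification_map:
  assumes "pred_stratification Q L" and "r \<in> Q"
    and "L (pred' (f (head r))) = L (pred (head r))"
    and "\<And>b. L (pred'' (g b)) = L (pred (fst b))"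
  shows "Pos c \<in> set (body (map_rule f g r)) \<Longrightarrow>
      L (pred'' c) \<le> L (pred' (head (map_rule f g r)))"
    and "Neg c \<in> set (body (map_rule f g r)) \<Longrightarrow>
      L (pred'' c) < L (pred' (head (map_rule f g r)))"
  using assms unfolding pred_stratification_def Pos_in_body_map_rule Neg_in_body_map_rule
    rule.map_sel(1)
  by metis+

lemma local_stratification_pred:
  assumes "pred_stratification Q L"
  shows "local_stratification Q (\<lambda>b. L (pred (fst b)))"
  unfolding local_stratification_def
proof (intro ballI)
  fix r l assume "r \<in> td_ground Q" and l: "l \<in> set (body r)"
  then obtain r' \<sigma> t where r': "r' \<in> Q"
    and r: "r = map_rule (\<lambda>a. (atm_inst \<sigma> a, t)) (\<lambda>(a, k). (atm_inst \<sigma> a, t - k)) r'"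
    unfolding td_ground_def by blast
  note le = pred_stratification_map[OF assms r', where pred' = "\<lambda>b. pred (fst b)"
      and pred'' = "\<lambda>b. pred (fst b)" and f = "\<lambda>a. (atm_inst \<sigma> a, t)"
      and g = "\<lambda>(a, k). (atm_inst \<sigma> a, t - k)", folded r]
  show "case l of Pos b \<Rightarrow> 0 < snd b \<longrightarrow> L (pred (fst b)) \<le> L (pred (fst (head r)))
      | Neg b \<Rightarrow> 0 < snd b \<longrightarrow> L (pred (fst b)) < L (pred (fst (head r)))"
    using l le by - (cases l, auto simp: atm.map_sel case_prod_beta)
qed

lemma pred_stratification_delete_objects:
  assumes "pred_stratification Q L"
  shows "pred_stratification (delete_objects ` Q) L"
proof -
  have "L (pred (fst b)) \<le> L (pred (head (delete_objects r)))"
    if "r \<in> Q" "Pos b \<in> set (body (delete_objects r))" for r b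
    using that(2) unfolding delete_objects_def
    by (rule pred_stratification_map(1)[OF assms that(1), rotated 2]) (auto simp: case_prod_beta)
  moreover have "L (pred (fst b)) < L (pred (head (delete_objects r)))"
    if "r \<in> Q" "Neg b \<in> set (body (delete_objects r))" for r b
    using that(2) unfolding delete_objects_def
    by (rule pred_stratification_map(2)[OF assms that(1), rotated 2]) (auto simp: case_prod_beta)
  ultimately show ?thesis unfolding pred_stratification_def by blast
qed

text \<open>Only an inequality, because a window condition may become \<open>Bot\<close>, of level
  0.\<close>

lemma td_level_tr_cond: "td_level st (pred (fst (tr_cond \<mu> e))) \<le> Suc (st (pred (atom_of e)))"
  by (cases e) auto

lemma pred_stratification_pLARS2TD:
  assumes "global_stratification P n st"
  shows "pred_stratification (pLARS2TD ar P) (td_level st)"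
proof -
  have "(\<forall>b. Pos b \<in> set (body r') \<longrightarrow> td_level st (pred (fst b)) \<le> td_level st (pred (head r'))) \<and>
     (\<forall>b. Neg b \<in> set (body r') \<longrightarrow> td_level st (pred (fst b)) < td_level st (pred (head r')))"
    if "r' \<in> pLARS2TD ar P" for r'
    using that
  proof (cases rule: pLARS2TD_cases)
    case (rule r \<mu>)
    have "td_level st (pred (fst b)) \<le> td_level st (pred (head r'))"
      if b: "Pos b \<in> set (body r')" for b
    proof -
      obtain e where "b = tr_cond \<mu> e" "Pos e \<in> set (body r)"
        using b unfolding rule(3) Pos_in_body_tr_rule by blast
      then show ?thesis
        using td_level_tr_cond[of st \<mu> e] global_stratification_Pos[OF assms rule(1), of e]
        by (simp add: rule(3) head_tr_rule)
    qed
    moreover have "td_level st (pred (fst b)) < td_level st (pred (head r'))"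
      if b: "Neg b \<in> set (body r')" for b
    proof -
      obtain e where "b = tr_cond \<mu> e" "Neg e \<in> set (body r)"
        using b unfolding rule(3) Neg_in_body_tr_rule by blast
      then show ?thesis
        using td_level_tr_cond[of st \<mu> e] global_stratification_Neg[OF assms rule(1), of e]
        by (simp add: rule(3) head_tr_rule)
    qed
    ultimately show ?thesis by blast
  qed auto
  then show ?thesis unfolding pred_stratification_def by blast
qed

section \<open>Arities and offsets\<close>

lemma args_tr_cond:
  "has_arity ar (atom_of e) \<Longrightarrow>
     length (args (fst (tr_cond \<mu> e))) + 1 = td_arity ar (pred (fst (tr_cond \<mu> e)))"
  by (cases e) (auto simp: has_arity_def)

lemma tr_cond_offset_nonneg: "0 \<le> snd (tr_cond \<mu> e)"
  by (cases e) auto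

lemma td_program_pLARS2TD:
  assumes "plain_lars_program ar P" and "globally_stratified P"
  shows "td_program (td_arity ar) (pLARS2TD ar P)"
proof -
  have "length (args (head r')) + 1 = td_arity ar (pred (head r')) \<and>
    (\<forall>b \<in> body_conds r'. length (args (fst b)) + 1 = td_arity ar (pred (fst b)) \<and> 0 \<le> snd b)"
    if "r' \<in> pLARS2TD ar P" for r'
    using that
  proof (cases rule: pLARS2TD_cases)
    case (rule r \<mu>)
    have "has_arity ar (head r)" using assms(1) rule(1) unfolding plain_lars_program_def by blast
    then have "length (args (head r')) + 1 = td_arity ar (pred (head r'))"
      by (simp add: rule(3) head_tr_rule has_arity_def)
    moreover have "length (args (fst b)) + 1 = td_arity ar (pred (fst b)) \<and> 0 \<le> snd b"
      if b: "b \<in> body_conds r'" for b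
    proof -
      obtain e where e: "b = tr_cond \<mu> e" "e \<in> body_conds r"
        using b unfolding rule(3) body_conds_iff Pos_in_body_tr_rule Neg_in_body_tr_rule by blast
      then have "has_arity ar (atom_of e)"
        using assms(1) rule(1) unfolding plain_lars_program_def by blast
      then show ?thesis using args_tr_cond tr_cond_offset_nonneg e(1) by blast
    qed
    ultimately show ?thesis by blast
  qed (auto simp: body_conds_iff)
  moreover have "temporally_stratified (pLARS2TD ar P)"
    using assms(2) pred_stratification_pLARS2TD pred_stratification_delete_objects
      local_stratification_pred
    unfolding temporally_stratified_def locally_stratified_def globally_stratified_def by blast
  ultimately show ?thesis
    unfolding td_program_def forward_propagating_def by (auto simp: case_prod_beta)
qed

section \<open>The perfect model of the translated program\<close>

text \<open>Not recursive: the auxiliary clauses refer to \<open>M\<close>, and the inductive form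
  serves for its case rules. Their guards mirror derivability: the auxiliary rules exist only for
  conditions occurring in \<open>P\<close>, and their heads have exactly \<open>ar p\<close> object
  arguments. \<open>Bot\<close> has no clause and is thus false.\<close>

inductive_set td_model ::
  "('p \<Rightarrow> nat) \<Rightarrow> ('p, 'o) lars_rule set \<Rightarrow> (('p, 'o) atm \<times> int) set \<Rightarrow>
     (('p tdpred, 'o) atm \<times> int) set"
  for ar :: "'p \<Rightarrow> nat" and P :: "('p, 'o) lars_rule set" and M :: "(('p, 'o) atm \<times> int) set"
where
  orig: "(Atm p xs, t) \<in> M \<Longrightarrow> (Atm (Orig p) xs, t) \<in> td_model ar P M"
| dia: "r \<in> P \<Longrightarrow> WinDia d (Atm p ys) \<in> body_conds r \<Longrightarrow> 0 < t \<Longrightarrow> length xs = ar p \<Longrightarrow>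
    lars_sat M t (WinDia d (Atm p xs)) \<Longrightarrow> (Atm (DiaP p d) xs, t) \<in> td_model ar P M"
| box: "r \<in> P \<Longrightarrow> WinBox d (Atm p ys) \<in> body_conds r \<Longrightarrow> 0 < t \<Longrightarrow> length xs = ar p \<Longrightarrow>
    lars_sat M t (WinBox d (Atm p xs)) \<Longrightarrow> (Atm (BoxP p d) xs, t) \<in> td_model ar P M"

lemma td_model_mono:
  assumes "M \<subseteq> N"
  shows "td_model ar P M \<subseteq> td_model ar P N"
proof safe
  fix a t assume "(a, t) \<in> td_model ar P M"
  then show "(a, t) \<in> td_model ar P N"
  proof cases
    case orig
    then show ?thesis using assms by (auto intro: td_model.orig)
  next
    case dia
    then show ?thesis using lars_sat_mono[OF assms] by (metis td_model.dia)
  next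
    case box
    then show ?thesis using lars_sat_mono[OF assms] by (metis td_model.box)
  qed
qed

inductive_simps td_model_Orig: "(Atm (Orig p) xs, t) \<in> td_model ar P M"
inductive_simps td_model_DiaP: "(Atm (DiaP p d) xs, t) \<in> td_model ar P M"
inductive_simps td_model_BoxP: "(Atm (BoxP p d) xs, t) \<in> td_model ar P M"
inductive_simps td_model_Bot: "(Atm Bot xs, t) \<in> td_model ar P M"

abbreviation td_inst ::
  "(nat \<Rightarrow> 'o) \<Rightarrow> int \<Rightarrow> ('q, 'o oterm) atm \<times> int \<Rightarrow> ('q, 'o) atm \<times> int" where
  "td_inst \<sigma> t \<equiv> \<lambda>(a, k). (atm_inst \<sigma> a, t - k)"

text \<open>With \<open>\<tau> T' = t - int (\<mu> T')\<close>, the bound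
  \<open>\<tau> T' \<le> t\<close> is automatic and \<open>t - int d \<le> \<tau> T'\<close> says
  \<open>\<mu> T' \<le> d\<close>, the test that chooses between the atom and \<open>Bot\<close>.
  The arity of the condition meets the length guard of \<open>td_model\<close>.\<close>

lemma td_model_tr_cond:
  assumes "plain_lars_program ar P" and "r \<in> P" "e \<in> body_conds r" and "0 < t"
    and "\<And>T'. T' \<in> time_vars r \<Longrightarrow> \<tau> T' = t - int (\<mu> T')"
  shows "td_inst \<sigma> t (tr_cond \<mu> e) \<in> td_model ar P M \<longleftrightarrow>
    lars_sat M t (map_ext id \<tau> (oterm_inst \<sigma>) e)"
proof -
  have arity: "length (args (atom_of e)) = ar (pred (atom_of e))"
    using assms(1-3) unfolding plain_lars_program_def has_arity_def by blast
  have "\<And>T'. T' \<in> set2_ext e \<Longrightarrow> \<tau> T' = t - int (\<mu> T')"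
    using assms(3,5) unfolding time_vars_def by blast
  then show ?thesis
    using arity assms(2-4)
    by (cases e; cases "atom_of e")
      (auto simp: td_model_Orig td_model_DiaP td_model_BoxP td_model_Bot)
qed

text \<open>Safety of the rule ensures that \<open>first_window\<close> is the size of an actual
  positive condition and not the default 0 of the empty list. That condition ties
  \<open>\<tau>\<close> to \<open>\<mu>\<close> in both directions of the comparison.\<close>

lemma time_var_first_window:
  assumes "plain_lars_program ar P" "r \<in> P" "T' \<in> time_vars r"
  obtains a where "Pos (WinAt (first_window T' (body r)) T' a) \<in> set (body r)"
proof -
  have "\<exists>a. Pos (WinAt (first_window T' ls) T' a) \<in> set ls" if "Pos (WinAt d T' a) \<in> set ls"
    for d a and ls :: "('p, nat, 'o oterm) ext literal list"
    using that by (induction T' ls rule: first_window.induct) auto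
  moreover have "\<exists>d a. Pos (WinAt d T' a) \<in> set (body r)"
    using assms unfolding plain_lars_program_def by blast
  ultimately show thesis using that by blast
qed

text \<open>The substitution \<open>(!) xs\<close> makes the generic auxiliary rules reach any
  ground tuple \<open>xs\<close> of the right length.\<close>

lemma var_tuple_inst: "map (oterm_inst ((!) xs)) (var_tuple (length xs)) = xs"
  by (rule nth_equalityI) (auto simp: var_tuple_def)

text \<open>Positive rules are not affected by the reduct, so that every closed set contains the
  intended extension of the auxiliary predicates over its own \<open>Orig\<close> atoms.\<close>

lemma td_model_subset_reduct_closed:
  assumes "reduct_closed (\<lambda>M b. b \<in> M) (td_ground (pLARS2TD ar P)) F timed N X"
  shows "td_model ar P {(Atm p xs, t) | p xs t. (Atm (Orig p) xs, t) \<in> X} \<subseteq> X"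
proof -
  have closed: "(atm_inst \<sigma> h, t) \<in> X"
    if "Rule h (map Pos bs) \<in> pLARS2TD ar P" "0 < t" "td_inst \<sigma> t ` set bs \<subseteq> X" for h bs \<sigma> t
  proof -
    let ?r = "map_rule (\<lambda>a. (atm_inst \<sigma> a, t)) (td_inst \<sigma> t) (Rule h (map Pos bs))"
    have "?r \<in> td_ground (pLARS2TD ar P)" using that(1,2) unfolding td_ground_def by blast
    moreover have "body_holds (\<lambda>M b. b \<in> M) X N ?r"
      unfolding body_holds_map_rule using that(3) by auto
    moreover have "head ?r \<in> timed" using that(2) by simp
    ultimately have "head ?r \<in> X" by (rule reduct_closedD(3)[OF assms])
    then show ?thesis by simp
  qed
  have "(a, t) \<in> X"
    if "(a, t) \<in> td_model ar P {(Atm p xs, t) | p xs t. (Atm (Orig p) xs, t) \<in> X}" for a t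
    using that
  proof cases
    case (orig p xs)
    then show ?thesis by simp
  next
    case (dia r d p ys xs)
    from dia(6) obtain s where s: "t - int d \<le> s" "s \<le> t" "(Atm (Orig p) xs, s) \<in> X" by auto
    \<comment> \<open>The window witness \<open>s\<close> selects the diamond rule with offset
      \<open>t - s\<close>.\<close>
    then have "nat (t - s) \<le> d" by linarith
    then have "Rule (Atm (DiaP p d) (var_tuple (ar p)))
        (map Pos [(Atm (Orig p) (var_tuple (ar p)), int (nat (t - s)))]) \<in> pLARS2TD ar P"
      using dia_rule_in_pLARS2TD[OF dia(2,3)] by (simp only: list.map)
    from closed[OF this dia(4), of "(!) xs"] s show ?thesis
      by (simp add: dia(1) var_tuple_inst dia(5)[symmetric])
  next
    case (box r d p ys xs)
    have rule: "Rule (Atm (BoxP p d) (var_tuple (ar p)))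
        (map Pos (map (\<lambda>i. (Atm (Orig p) (var_tuple (ar p)), int i)) [0..<d + 1])) \<in> pLARS2TD ar P"
      using box_rule_in_pLARS2TD[OF box(2,3)] by (simp only: map_map comp_def)
    have "(Atm (Orig p) xs, t - int i) \<in> X" if "i \<le> d" for i
      using box(6) that by simp
    then have "(atm_inst ((!) xs) (Atm (BoxP p d) (var_tuple (ar p))), t) \<in> X"
      by (intro closed[OF rule box(4)]) (auto simp: var_tuple_inst box(5)[symmetric] simp del: upt_Suc)
    then show ?thesis by (simp add: box(1) var_tuple_inst box(5)[symmetric])
  qed
  then show ?thesis by auto
qed

lemma stream_facts_iff: "(Atm q xs, t) \<in> stream_facts S \<longleftrightarrow> (\<exists>p. q = Orig p \<and> (Atm p xs, t) \<in> S)"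
proof -
  have eq: "map_atm Orig id a = Atm q xs \<longleftrightarrow> (\<exists>p. q = Orig p \<and> a = Atm p xs)" for a :: "('a, 'b) atm"
    by (cases a) auto
  show ?thesis
  proof
    assume "(Atm q xs, t) \<in> stream_facts S"
    then obtain a where "(a, t) \<in> S" "map_atm Orig id a = Atm q xs"
      by (auto simp: stream_facts_def)
    then show "\<exists>p. q = Orig p \<and> (Atm p xs, t) \<in> S" by (auto simp: eq)
  next
    assume "\<exists>p. q = Orig p \<and> (Atm p xs, t) \<in> S"
    then obtain p where "q = Orig p" "(Atm p xs, t) \<in> S" by blast
    then show "(Atm q xs, t) \<in> stream_facts S"
      unfolding stream_facts_def by (intro image_eqI[of _ _ "(Atm p xs, t)"]) auto
  qed
qed

text \<open>Closure: a temporal instance firing in \<open>td_model ar P M\<close> comes from a LARS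
  instance firing in \<open>M\<close>, or is an auxiliary rule, true by the window semantics.
  Minimality: for a closed \<open>X\<close>, let \<open>Y\<close> be its original part. Then
  \<open>Y\<close> is closed under the LARS reduct by \<open>M\<close>, so
  \<open>M \<subseteq> Y\<close>, and monotonicity gives
  \<open>td_model ar P M \<subseteq> td_model ar P Y \<subseteq> X\<close>.\<close>

lemma td_stable_td_model:
  assumes plain: "plain_lars_program ar P" and M: "lars_stable P S M"
  shows "td_stable (pLARS2TD ar P) (stream_facts S) (td_model ar P M)"
  unfolding stable_def
proof (intro conjI allI impI)
  note M1 = reduct_closedD(1,2)[OF stableD(1)[OF M]]
    and M2 = reduct_closedD(3)[OF stableD(1)[OF M]]
    and M3 = stableD(2)[OF M]
  let ?I = "td_model ar P M"
  show "reduct_closed (\<lambda>M b. b \<in> M) (td_ground (pLARS2TD ar P)) (stream_facts S) timed ?I ?I"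
    unfolding reduct_closed_def
  proof (intro conjI ballI impI)
    show timed: "?I \<subseteq> timed"
    proof safe
      fix a t assume "(a, t) \<in> ?I"
      then show "0 < t" using M1(1) by cases auto
    qed
    show "stream_facts S \<inter> timed \<subseteq> ?I"
    proof safe
      fix a t assume "(a, t) \<in> stream_facts S" "0 < t"
      then show "(a, t) \<in> ?I"
        using M1(2) by (cases a) (auto simp: stream_facts_iff intro: td_model.orig)
    qed
    fix r0 assume "r0 \<in> td_ground (pLARS2TD ar P)"
      and holds: "body_holds (\<lambda>M b. b \<in> M) ?I ?I r0"
    then obtain r' \<sigma> t where r': "r' \<in> pLARS2TD ar P" and t: "0 < t"
      and r0: "r0 = map_rule (\<lambda>a. (atm_inst \<sigma> a, t)) (td_inst \<sigma> t) r'"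
      unfolding td_ground_def by blast
    have pos: "\<And>b. Pos b \<in> set (body r') \<Longrightarrow> td_inst \<sigma> t b \<in> ?I"
      and neg: "\<And>b. Neg b \<in> set (body r') \<Longrightarrow> td_inst \<sigma> t b \<notin> ?I"
      using holds unfolding r0 body_holds_map_rule by blast+
    have head: "head r0 = (atm_inst \<sigma> (head r'), t)" by (simp add: r0 rule.map_sel(1))
    from r' show "head r0 \<in> ?I"
    proof (cases rule: pLARS2TD_cases)
      case (rule r \<mu>)
      \<comment> \<open>\<open>lars_ground\<close> demands positive values for all time variables,
        also for those outside the rule, where \<open>t - int (\<mu> T')\<close> may be
        non-positive; the value 1 is a filler for these.\<close>
      define \<tau> where "\<tau> = (\<lambda>T'. if int (\<mu> T') < t then t - int (\<mu> T') else 1)"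
      have \<tau>: "\<tau> T' = t - int (\<mu> T')" if T': "T' \<in> time_vars r" for T'
      proof -
        obtain a where "Pos (WinAt (first_window T' (body r)) T' a) \<in> set (body r)"
          using time_var_first_window[OF plain rule(1) T'] .
        from pos[unfolded rule(3) Pos_in_body_tr_rule, OF exI, OF conjI, OF refl this]
        have "(Atm (Orig (pred a)) (map (oterm_inst \<sigma>) (args a)), t - int (\<mu> T')) \<in> ?I"
          using rule(2) T' by simp
        then show ?thesis using timed by (auto simp: \<tau>_def)
      qed
      have cond: "td_inst \<sigma> t (tr_cond \<mu> e) \<in> ?I \<longleftrightarrow>
          lars_sat M t (map_ext id \<tau> (oterm_inst \<sigma>) e)" if "e \<in> body_conds r" for e
        by (rule td_model_tr_cond[OF plain rule(1) that t \<tau>])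
      let ?r = "map_rule (\<lambda>a. (atm_inst \<sigma> a, t)) (\<lambda>e. (t, map_ext id \<tau> (oterm_inst \<sigma>) e)) r"
      have "?r \<in> lars_ground P"
        using rule(1) t unfolding lars_ground_def \<tau>_def by fastforce
      moreover have "body_holds lars_cond_sat M M ?r"
        unfolding body_holds_map_rule split
      proof (intro conjI allI impI)
        fix e assume "Pos e \<in> set (body r)"
        then show "lars_sat M t (map_ext id \<tau> (oterm_inst \<sigma>) e)"
          using pos[of "tr_cond \<mu> e"] cond[of e]
          by (auto simp: rule(3) Pos_in_body_tr_rule body_conds_iff simp del: split_paired_Ex)
      next
        fix e assume "Neg e \<in> set (body r)"
        then show "\<not> lars_sat M t (map_ext id \<tau> (oterm_inst \<sigma>) e)"
          using neg[of "tr_cond \<mu> e"] cond[of e]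
          by (auto simp: rule(3) Neg_in_body_tr_rule body_conds_iff simp del: split_paired_Ex)
      qed
      ultimately have "(atm_inst \<sigma> (head r), t) \<in> M"
        using M2[of ?r] t by (auto simp: rule.map_sel(1))
      then show ?thesis
        by (cases "head r") (simp add: head rule(3) head_tr_rule td_model.orig)
    next
      case (dia r d p xs i)
      then have "(Atm p (map (oterm_inst \<sigma>) (var_tuple (ar p))), t - int i) \<in> M"
        using pos by (auto simp: td_model_Orig)
      with dia t show ?thesis
        by (auto simp: head td_model_DiaP intro!: bexI[of _ "t - int i"])
    next
      case (box r d p xs)
      have "(Atm p (map (oterm_inst \<sigma>) (var_tuple (ar p))), s) \<in> M" if "s \<in> {t - int d..t}" for s
      proof -
        have "nat (t - s) \<in> set [0..<d + 1]" using that by auto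
        then have "Pos (Atm (Orig p) (var_tuple (ar p)), int (nat (t - s))) \<in> set (body r')"
          unfolding box(3) rule.sel set_map by (rule imageI)
        then show ?thesis using pos that by (fastforce simp: td_model_Orig)
      qed
      with box t show ?thesis by (auto simp: head td_model_BoxP)
    qed
  qed
  fix X
  assume X: "reduct_closed (\<lambda>M b. b \<in> M) (td_ground (pLARS2TD ar P)) (stream_facts S) timed ?I X"
  note X1 = reduct_closedD(1,2)[OF X]
    and X2 = reduct_closedD(3)[OF X]
  define Y where "Y = {(Atm p xs, t) | p xs t. (Atm (Orig p) xs, t) \<in> X}"
  have IY: "td_model ar P Y \<subseteq> X" unfolding Y_def by (rule td_model_subset_reduct_closed[OF X])
  have "reduct_closed lars_cond_sat (lars_ground P) S timed M Y"
    unfolding reduct_closed_def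
  proof (intro conjI ballI impI)
    show Y: "Y \<subseteq> timed" using X1(1) unfolding Y_def by blast
    show "S \<inter> timed \<subseteq> Y"
    proof
      fix b assume b: "b \<in> S \<inter> timed"
      obtain p xs t where [simp]: "b = (Atm p xs, t)" by (metis atm.exhaust surj_pair)
      have "(Atm (Orig p) xs, t) \<in> stream_facts S"
        using b by (simp add: stream_facts_iff)
      then show "b \<in> Y" using b X1(2) unfolding Y_def by auto
    qed
    fix r0 assume "r0 \<in> lars_ground P" and holds: "body_holds lars_cond_sat Y M r0"
    then obtain r \<sigma> \<tau> t where r: "r \<in> P" and t: "0 < t"
      and r0: "r0 = map_rule (\<lambda>a. (atm_inst \<sigma> a, t)) (\<lambda>e. (t, map_ext id \<tau> (oterm_inst \<sigma>) e)) r"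
      unfolding lars_ground_def by blast
    have pos: "\<And>e. Pos e \<in> set (body r) \<Longrightarrow> lars_sat Y t (map_ext id \<tau> (oterm_inst \<sigma>) e)"
      and neg: "\<And>e. Neg e \<in> set (body r) \<Longrightarrow> \<not> lars_sat M t (map_ext id \<tau> (oterm_inst \<sigma>) e)"
      using holds unfolding r0 body_holds_map_rule by auto
    \<comment> \<open>The first window condition of \<open>T'\<close> holds in \<open>Y\<close>: its
      upper bound \<open>\<tau> T' \<le> t\<close> makes the truncation by \<open>nat\<close>
      harmless, and its lower bound makes \<open>\<mu>\<close> admissible for the
      translation.\<close>
    define \<mu> where "\<mu> = (\<lambda>T'. nat (t - \<tau> T'))"
    have win: "\<mu> T' \<le> first_window T' (body r)" and \<mu>: "\<tau> T' = t - int (\<mu> T')"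
      if T': "T' \<in> time_vars r" for T'
    proof -
      obtain a where "Pos (WinAt (first_window T' (body r)) T' a) \<in> set (body r)"
        using time_var_first_window[OF plain r T'] .
      from pos[OF this] show "\<mu> T' \<le> first_window T' (body r)" "\<tau> T' = t - int (\<mu> T')"
        unfolding \<mu>_def by auto
    qed
    \<comment> \<open>Stated for every \<open>N\<close>: positive conditions are compared over
      \<open>Y\<close>, negated ones over \<open>M\<close>.\<close>
    have cond: "td_inst \<sigma> t (tr_cond \<mu> e) \<in> td_model ar P N \<longleftrightarrow>
        lars_sat N t (map_ext id \<tau> (oterm_inst \<sigma>) e)" if "e \<in> body_conds r" for e N
      by (rule td_model_tr_cond[OF plain r that t \<mu>])
    let ?r = "map_rule (\<lambda>a. (atm_inst \<sigma> a, t)) (td_inst \<sigma> t) (tr_rule \<mu> r)"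
    have "?r \<in> td_ground (pLARS2TD ar P)"
      using tr_rule_in_pLARS2TD[OF r] win t unfolding td_ground_def by blast
    moreover have "body_holds (\<lambda>M b. b \<in> M) X ?I ?r"
      unfolding body_holds_map_rule
    proof (intro conjI allI impI)
      fix b assume "Pos b \<in> set (body (tr_rule \<mu> r))"
      then obtain e where e: "b = tr_cond \<mu> e" "Pos e \<in> set (body r)"
        unfolding Pos_in_body_tr_rule by blast
      then have "td_inst \<sigma> t b \<in> td_model ar P Y"
        using pos[of e] cond[of e Y] by (simp add: body_conds_iff)
      \<comment> \<open>\<open>X\<close> may contain more auxiliary atoms than
        \<open>td_model ar P Y\<close>, but a lower bound suffices for positive conditions. Negated
        ones are read in \<open>?I\<close>, where the correspondence is exact.\<close>
      then show "td_inst \<sigma> t b \<in> X" by (rule subsetD[OF IY])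
    next
      fix b assume "Neg b \<in> set (body (tr_rule \<mu> r))"
      then obtain e where e: "b = tr_cond \<mu> e" "Neg e \<in> set (body r)"
        unfolding Neg_in_body_tr_rule by blast
      then show "td_inst \<sigma> t b \<notin> ?I"
        using neg[of e] cond[of e M] by (simp add: body_conds_iff)
    qed
    ultimately have "(atm_inst \<sigma> (head (tr_rule \<mu> r)), t) \<in> X"
      using X2[of ?r] t by (auto simp: rule.map_sel(1))
    then show "head r0 \<in> Y"
      by (cases "head r") (simp add: r0 rule.map_sel(1) head_tr_rule Y_def)
  qed
  then have "M \<subseteq> Y" by (rule M3)
  then have "?I \<subseteq> td_model ar P Y" by (rule td_model_mono)
  with IY show "?I \<subseteq> X" by blast
qed

text \<open>Traces an auxiliary predicate back to the condition of \<open>P\<close> that introduced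
  it, which is the guard in \<open>td_model\<close>.\<close>

lemma td_preds_pLARS2TD:
  assumes "q \<in> td_preds (pLARS2TD ar P)"
  shows "(\<exists>p. q = Orig p) \<or> q = Bot \<or>
    (\<exists>r \<in> P. \<exists>d p xs. q = DiaP p d \<and> WinDia d (Atm p xs) \<in> body_conds r) \<or>
    (\<exists>r \<in> P. \<exists>d p xs. q = BoxP p d \<and> WinBox d (Atm p xs) \<in> body_conds r)"
proof -
  obtain r' where r': "r' \<in> pLARS2TD ar P"
    and q: "q = pred (head r') \<or> q \<in> (\<lambda>b. pred (fst b)) ` body_conds r'"
    using assms unfolding td_preds_def case_prod_beta by blast
  from r' show ?thesis
  proof (cases rule: pLARS2TD_cases)
    case (rule r \<mu>)
    from q consider "q = Orig (pred (head r))"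
      | e where "e \<in> body_conds r" "q = pred (fst (tr_cond \<mu> e))"
      unfolding rule(3) head_tr_rule image_iff Bex_def body_conds_iff Pos_in_body_tr_rule
        Neg_in_body_tr_rule atm.sel by blast
    then show ?thesis
    proof cases
      case 2
      then show ?thesis using rule(1)
        by (cases e; cases "atom_of e") (auto split: if_splits)
    qed simp
  next
    case dia
    with q show ?thesis by (auto simp: body_conds_iff)
  next
    case box
    with q show ?thesis by (auto simp: body_conds_iff)
  qed
qed

theorem theorem1:
  fixes P :: "('p, 'o) lars_rule set"
    and S :: "(('p, 'o) atm \<times> int) set"
    and ar :: "'p \<Rightarrow> nat"
  assumes "plain_lars_program ar P"
    and "globally_stratified P"
    and "is_stream ar P S"
  shows "td_program (td_arity ar) (pLARS2TD ar P) \<and>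
    (let P' = pLARS2TD ar P;
         I = perfect_model P' (stream_facts S)
     in \<forall>t p X t' d. 0 < t \<longrightarrow> p \<in> lars_preds P \<longrightarrow> length X = ar p \<longrightarrow> 0 < t' \<longrightarrow> 0 < d \<longrightarrow>
          (lars_derives P S t (Plain (Atm p X)) \<longleftrightarrow> (Atm (Orig p) X, t) \<in> I) \<and>
          (lars_derives P S t (At t' (Atm p X)) \<longleftrightarrow> (Atm (Orig p) X, t') \<in> I) \<and>
          (lars_derives P S t (WinAt d t' (Atm p X)) \<longleftrightarrow>
             (Atm (Orig p) X, t') \<in> I \<and> t - int d \<le> t' \<and> t' \<le> t) \<and>
          (DiaP p d \<in> td_preds P' \<longrightarrow>
             (lars_derives P S t (WinDia d (Atm p X)) \<longleftrightarrow> (Atm (DiaP p d) X, t) \<in> I)) \<and>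
          (BoxP p d \<in> td_preds P' \<longrightarrow>
             (lars_derives P S t (WinBox d (Atm p X)) \<longleftrightarrow> (Atm (BoxP p d) X, t) \<in> I)))"
proof -
  define M where "M = lars_model P S"
  obtain n st where st: "global_stratification P n st"
    using assms(2) unfolding globally_stratified_def by blast
  have "td_stable (pLARS2TD ar P) (stream_facts S) (td_model ar P M)"
    unfolding M_def by (intro td_stable_td_model lars_stable_lars_model assms)
  then have I: "perfect_model (pLARS2TD ar P) (stream_facts S) = td_model ar P M"
    using perfect_model_eqI local_stratification_pred pred_stratification_pLARS2TD[OF st] by blast
  \<comment> \<open>The three premises are exactly what the guards of \<open>td_model\<close> ask
    for, so only the window condition itself remains.\<close>
  have "lars_sat M t (WinDia d (Atm p X)) \<longleftrightarrow> (Atm (DiaP p d) X, t) \<in> td_model ar P M"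
    if "0 < t" "length X = ar p" "DiaP p d \<in> td_preds (pLARS2TD ar P)" for t d p X
    using that(1,2) td_preds_pLARS2TD[OF that(3)] unfolding td_model_DiaP by auto
  moreover have "lars_sat M t (WinBox d (Atm p X)) \<longleftrightarrow> (Atm (BoxP p d) X, t) \<in> td_model ar P M"
    if "0 < t" "length X = ar p" "BoxP p d \<in> td_preds (pLARS2TD ar P)" for t d p X
    using that(1,2) td_preds_pLARS2TD[OF that(3)] unfolding td_model_BoxP by auto
  ultimately show ?thesis
    using td_program_pLARS2TD[OF assms(1,2)]
    unfolding Let_def I lars_derives_def M_def[symmetric]
    by (auto simp: td_model_Orig simp del: lars_sat.simps(4,5))
qed

end
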